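(* Let $n\ge 1$ be an integer, let $\omega\in\mathbb{C}$, and let $\mathbf{M}_n\in\mathbb{C}^{n\times(n+1)}$ be the matrix with entries $1$ on the main diagonal (positions $(j,j)$, $1\le j\le n$), entries $\omega$ on the superdiagonal (positions $(j,j+1)$, $1\le j\le n$), and zeros elsewhere. Let $\mathbf{A}_n=\mathbf{M}_n\mathbf{M}_n^*$. Then $$S(\mathbf{M}_n)=\sqrt{|\det(\mathbf{A}_n)|}\le \begin{cases}\dfrac{1}{\sqrt{1-|\omega|^2}} & |\omega|<1,\\[2mm] \sqrt{n+1} & |\omega|=1,\\[2mm] \dfrac{|\omega|^n}{\sqrt{1-\frac{1}{|\omega|^2}}} & |\omega|>1.\end{cases}$$
   Context: $*$ denotes the Hermitian transpose. For a matrix $\mathbf{M}$ with at least as many columns as rows, the generalized determinant is $S(\mathbf{M}):=\sqrt{|\det(\mathbf{M}\mathbf{M}^* )|}$, the product of the singular values of $\mathbf{M}$ (as many as there are rows). *)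

theory Defs
  imports Complex_Main "Jordan_Normal_Form.Matrix" "Jordan_Normal_Form.Determinant"
    "Jordan_Normal_Form.Schur_Decomposition"
begin

(* mat_adjoint is the Hermitian transpose: on complex entries, conjugate is cnj.
   The notion is meant for matrices with dim_row M \<le> dim_col M. *)
definition gen_det :: "complex mat \<Rightarrow> real" where
  "gen_det M = sqrt (cmod (det (M * mat_adjoint M)))"

(* Indices are 0-based, so position (j, j + 1) with 1 \<le> j \<le> n becomes (i, i + 1) with i < n. *)
definition bidiag_mat :: "nat \<Rightarrow> complex \<Rightarrow> complex mat" where
  "bidiag_mat n \<omega> =
     mat n (n + 1) (\<lambda>(i, j). if j = i then 1 else if j = i + 1 then \<omega> else 0)"

definition gram_mat :: "nat \<Rightarrow> complex \<Rightarrow> complex mat" where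
  "gram_mat n \<omega> = bidiag_mat n \<omega> * mat_adjoint (bidiag_mat n \<omega>)"

end

theory Submission
  imports Defs
begin

text \<open>The Gram matrix is tridiagonal Toeplitz with diagonal 1 + x and off-diagonal product x,
  where x is the squared modulus of the parameter. Its determinants satisfy the recurrence
  D(n+2) = (1 + x) D(n+1) - x D(n), so D(n) = 1 + x + ... + x^n. The three bounds come from
  summing this geometric series.\<close>

definition tridiag_mat :: "nat \<Rightarrow> 'a \<Rightarrow> 'a \<Rightarrow> 'a \<Rightarrow> 'a::comm_ring_1 mat" where
  "tridiag_mat n a b c =
     mat n n (\<lambda>(i, j). if j = i then a else if j = Suc i then b else if i = Suc j then c else 0)"

lemma tridiag_mat_carrier [simp]: "tridiag_mat n a b c \<in> carrier_mat n n"
  by (simp add: tridiag_mat_def)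

lemma det_tridiag_mat_0: "det (tridiag_mat 0 a b c) = 1"
  by (simp add: tridiag_mat_def)

lemma det_tridiag_mat_1: "det (tridiag_mat (Suc 0) a b c) = a"
  by (subst det_single) (auto simp: tridiag_mat_def)

text \<open>Laplace expansion along the first row leaves two minors. Deleting row and column 0 gives
  the next smaller matrix of the family. The other minor \<open>?B\<close> is not tridiagonal
  Toeplitz, but its first column has a single possibly nonzero entry, so one more expansion reduces
  it to size \<open>n\<close>.\<close>

lemma det_tridiag_mat_Suc_Suc:
  "det (tridiag_mat (Suc (Suc n)) a b c) =
     a * det (tridiag_mat (Suc n) a b c) - b * c * det (tridiag_mat n a b c)"
proof -
  let ?A = "tridiag_mat (Suc (Suc n)) a b c"
  let ?B = "mat_delete ?A 0 (Suc 0)"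
  have B: "?B \<in> carrier_mat (Suc n) (Suc n)"
    using mat_delete_carrier[of ?A "Suc (Suc n)" "Suc (Suc n)" 0 "Suc 0"] by simp
  have del00: "mat_delete ?A 0 0 = tridiag_mat (Suc n) a b c"
    by (rule eq_matI) (auto simp: mat_delete_def tridiag_mat_def)
  have delB: "mat_delete ?B 0 0 = tridiag_mat n a b c"
    by (rule eq_matI) (auto simp: mat_delete_def tridiag_mat_def)
  have B00: "?B $$ (0, 0) = c"
    by (simp add: mat_delete_def tridiag_mat_def)
  have "det ?B = (\<Sum>i<Suc n. ?B $$ (i, 0) * cofactor ?B i 0)"
    by (rule laplace_expansion_column[OF B]) simp
  also have "\<dots> = c * det (tridiag_mat n a b c) + (\<Sum>i<n. ?B $$ (Suc i, 0) * cofactor ?B (Suc i) 0)"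
    unfolding sum.lessThan_Suc_shift by (simp add: cofactor_def delB B00)
  \<comment> \<open>Column 0 of \<open>?A\<close> is supported on rows 0 and 1, and row 0 has been
    deleted.\<close>
  also have "(\<Sum>i<n. ?B $$ (Suc i, 0) * cofactor ?B (Suc i) 0) = 0"
    by (rule sum.neutral) (auto simp: mat_delete_def tridiag_mat_def)
  finally have detB: "det ?B = c * det (tridiag_mat n a b c)"
    by simp
  have "det ?A = (\<Sum>j<Suc (Suc n). ?A $$ (0, j) * cofactor ?A 0 j)"
    by (rule laplace_expansion_row[OF tridiag_mat_carrier]) simp
  also have "\<dots> = ?A $$ (0, 0) * cofactor ?A 0 0 + (?A $$ (0, 1) * cofactor ?A 0 1 +
      (\<Sum>j<n. ?A $$ (0, Suc (Suc j)) * cofactor ?A 0 (Suc (Suc j))))"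
    by (simp only: sum.lessThan_Suc_shift One_nat_def)
  also have "(\<Sum>j<n. ?A $$ (0, Suc (Suc j)) * cofactor ?A 0 (Suc (Suc j))) = 0"
    by (rule sum.neutral) (auto simp: tridiag_mat_def)
  also have "cofactor ?A 0 0 = det (tridiag_mat (Suc n) a b c)"
    by (simp add: cofactor_def del00)
  also have "cofactor ?A 0 1 = - (c * det (tridiag_mat n a b c))"
    by (simp add: cofactor_def detB)
  also have "?A $$ (0, 0) = a"
    by (simp add: tridiag_mat_def)
  also have "?A $$ (0, 1) = b"
    by (simp add: tridiag_mat_def)
  finally show ?thesis
    by (simp add: algebra_simps)
qed

text \<open>With diagonal \<open>1 + b * c\<close>, the recurrence says that each difference of
  successive determinants is \<open>b * c\<close> times the previous one, and the first difference
  is \<open>b * c\<close>.\<close>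

lemma det_tridiag_mat_geometric:
  "det (tridiag_mat n (1 + b * c) b c) = (\<Sum>k\<le>n. (b * c) ^ k)"
proof (induction n rule: induct_nat_012)
  case (ge2 n)
  then show ?case
    by (simp add: det_tridiag_mat_Suc_Suc algebra_simps)
qed (simp_all add: det_tridiag_mat_0 det_tridiag_mat_1)

lemma gram_mat_eq_tridiag_mat:
  "gram_mat n \<omega> = tridiag_mat n (1 + \<omega> * cnj \<omega>) \<omega> (cnj \<omega>)"
proof (rule eq_matI)
  fix i j
  assume "i < dim_row (tridiag_mat n (1 + \<omega> * cnj \<omega>) \<omega> (cnj \<omega>))"
    and "j < dim_col (tridiag_mat n (1 + \<omega> * cnj \<omega>) \<omega> (cnj \<omega>))"
  then have ij: "i < n" "j < n"
    by (auto simp: tridiag_mat_def)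
  let ?M = "\<lambda>i k. if k = i then 1 else if k = i + 1 then \<omega> else 0"
  have "gram_mat n \<omega> $$ (i, j) = (\<Sum>k<Suc n. ?M i k * cnj (?M j k))"
    using ij by (simp add: gram_mat_def bidiag_mat_def mat_adjoint_def scalar_prod_def
        mat_of_rows_def lessThan_atLeast0)
  also have "\<dots> = (\<Sum>k<Suc n. (if k = i then cnj (?M j i) else 0) +
      (if k = Suc i then \<omega> * cnj (?M j (Suc i)) else 0))"
    by (rule sum.cong) auto
  \<comment> \<open>Since \<open>i < n\<close>, the index \<open>Suc i\<close> is still one of the
    \<open>n + 1\<close> columns, even for the last row. Hence the last diagonal entry is not
    exceptional.\<close>
  also have "\<dots> = cnj (?M j i) + \<omega> * cnj (?M j (Suc i))"
    using ij by (simp add: sum.distrib del: sum.lessThan_Suc)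
  also have "\<dots> = tridiag_mat n (1 + \<omega> * cnj \<omega>) \<omega> (cnj \<omega>) $$ (i, j)"
    using ij by (auto simp: tridiag_mat_def)
  finally show "gram_mat n \<omega> $$ (i, j) = tridiag_mat n (1 + \<omega> * cnj \<omega>) \<omega> (cnj \<omega>) $$ (i, j)" .
qed (auto simp: gram_mat_def bidiag_mat_def tridiag_mat_def mat_adjoint_def)

lemma cmod_det_gram_mat: "cmod (det (gram_mat n \<omega>)) = (\<Sum>k\<le>n. ((cmod \<omega>)\<^sup>2) ^ k)"
proof -
  have "det (gram_mat n \<omega>) = of_real (\<Sum>k\<le>n. ((cmod \<omega>)\<^sup>2) ^ k)"
    unfolding gram_mat_eq_tridiag_mat det_tridiag_mat_geometric
    by (simp add: complex_norm_square[symmetric])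
  then show ?thesis
    \<comment> \<open>The determinant is a nonnegative real, so its modulus is the sum
      itself.\<close>
    by (simp only: norm_of_real) (simp add: sum_nonneg)
qed

text \<open>The closed form is \<open>(1 - x ^ Suc n) / (1 - x)\<close>; the subtracted power is
  dropped.\<close>

lemma sum_powers_le_of_less_1:
  fixes x :: real
  assumes "0 \<le> x" "x < 1"
  shows "(\<Sum>k\<le>n. x ^ k) \<le> 1 / (1 - x)"
  using assms by (simp add: sum_gp0 divide_right_mono)

text \<open>Here the closed form is \<open>(x ^ Suc n - 1) / (x - 1)\<close>. Dropping the
  \<open>- 1\<close> in the numerator and cancelling \<open>x\<close> gives the bound.\<close>

lemma sum_powers_le_of_greater_1:
  fixes x :: real
  assumes "1 < x"
  shows "(\<Sum>k\<le>n. x ^ k) \<le> x ^ n / (1 - 1 / x)"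
  using assms by (simp add: sum_gp0 field_simps)

theorem proposition3p4:
  fixes n :: nat and \<omega> :: complex
  assumes "n \<ge> 1"
  shows "gen_det (bidiag_mat n \<omega>) = sqrt (cmod (det (gram_mat n \<omega>))) \<and>
         sqrt (cmod (det (gram_mat n \<omega>))) \<le>
           (if cmod \<omega> < 1 then 1 / sqrt (1 - (cmod \<omega>)\<^sup>2)
            else if cmod \<omega> = 1 then sqrt (real n + 1)
            else cmod \<omega> ^ n / sqrt (1 - 1 / (cmod \<omega>)\<^sup>2))"
proof
  show "gen_det (bidiag_mat n \<omega>) = sqrt (cmod (det (gram_mat n \<omega>)))"
    by (simp add: gen_det_def gram_mat_def)
  let ?x = "(cmod \<omega>)\<^sup>2"
  consider "cmod \<omega> < 1" | "cmod \<omega> = 1" | "cmod \<omega> > 1"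
    by linarith
  then show "sqrt (cmod (det (gram_mat n \<omega>))) \<le>
           (if cmod \<omega> < 1 then 1 / sqrt (1 - (cmod \<omega>)\<^sup>2)
            else if cmod \<omega> = 1 then sqrt (real n + 1)
            else cmod \<omega> ^ n / sqrt (1 - 1 / (cmod \<omega>)\<^sup>2))"
  proof cases
    case 1
    then have "?x < 1"
      by (simp add: power_less_one_iff abs_square_less_1)
    then have "sqrt (\<Sum>k\<le>n. ?x ^ k) \<le> sqrt (1 / (1 - ?x))"
      by (intro real_sqrt_le_mono sum_powers_le_of_less_1) auto
    with 1 show ?thesis
      by (simp add: cmod_det_gram_mat real_sqrt_divide)
  next
    case 2
    \<comment> \<open>All \<open>n + 1\<close> summands equal 1, so equality holds in this
      case.\<close>
    then show ?thesis
      by (simp add: cmod_det_gram_mat)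
  next
    case 3
    then have "1 < ?x"
      by (simp add: one_less_power)
    then have "sqrt (\<Sum>k\<le>n. ?x ^ k) \<le> sqrt (?x ^ n / (1 - 1 / ?x))"
      by (intro real_sqrt_le_mono sum_powers_le_of_greater_1)
    also have "\<dots> = cmod \<omega> ^ n / sqrt (1 - 1 / ?x)"
      by (simp add: real_sqrt_divide real_sqrt_power)
    finally show ?thesis
      using 3 by (simp add: cmod_det_gram_mat)
  qed
qed

end
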